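(* Let $R$ be a finite truncated discrete valuation ring. Let $\theta\colon M\to\operatorname{Hom}(V,W)$ be a module representation over $R$. Suppose that $M$, $V$, and $W$ are finite. Then $$\operatorname{ask}(\Lambda(\theta))=\frac{|M|}{|V|}\cdot\operatorname{ask}^2(\theta^\bullet).$$
   Context: Rings are associative, commutative, and unital. Maps act on the right. A truncated discrete valuation ring is a ring isomorphic to $\mathfrak O/\mathfrak P^n$ for some discrete valuation ring $\mathfrak O$ with maximal ideal $\mathfrak P$ and some $n\ge 0$. A module representation over a ring $R$ is an $R$-module homomorphism $\theta\colon M\to\operatorname{Hom}(V,W)$, where $M,V,W$ are $R$-modules; write $x*_\theta a=x(a\theta)$ for $x\in V$, $a\in M$. If $M$ and $V$ are finite as sets and $m\ge0$, then $\operatorname{ask}^m(\theta)=\frac1{|M|}\sum_{a\in M}|\operatorname{Ker}(a\theta)|^m$ and $\operatorname{ask}(\theta)=\operatorname{ask}^1(\theta)$. Write $U^*=\operatorname{Hom}(U,R)$. The module representation $\theta^\bullet\colon W^*\to\operatorname{Hom}(V,M^* )$ is $\psi\mapsto\bigl(x\mapsto(a\mapsto(x(a\theta))\psi)\bigr)$. The alternating hull of $\theta$ is the module representation $\Lambda(\theta)\colon V\oplus M\to\operatorname{Hom}(V\oplus M,W)$ with $(x,a)*_{\Lambda(\theta)}(x',a')=x*_\theta a'-x'*_\theta a$ for $x,x'\in V$ and $a,a'\in M$; here $(x',a')$ is the element of the parameterising module $V\oplus M$ and $(x,a)$ is the vector it is applied to. *)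

theory Defs
  imports
    "HOL-Algebra.Ideal_Product"
    "HOL-Algebra.QuotRing"
    "HOL-Algebra.Ring_Divisibility"
    "Jordan_Normal_Form.Missing_VectorSpace"
begin

definition discrete_valuation_ring :: "('o, 'x) ring_scheme \<Rightarrow> bool"
  where "discrete_valuation_ring D \<longleftrightarrow>
    principal_domain D \<and> \<not> field D \<and> (\<exists>!P. maximalideal P D)"

text \<open>
  A truncated discrete valuation ring is a ring isomorphic to some \<open>D / P^n\<close>. HOL cannot
  quantify over the type of the elements of \<open>D\<close>, so this type is passed as an argument. As a
  hypothesis with \<open>'o\<close> a free type variable, the predicate covers all discrete valuation rings.
  The powers are taken in the monoid of ideals, whose unit is \<open>carrier D\<close>; hence \<open>n = 0\<close> gives the
  zero ring.
\<close>

definition truncated_dvr :: "'o itself \<Rightarrow> ('r, 'x) ring_scheme \<Rightarrow> bool"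
  where "truncated_dvr (_ :: 'o itself) R \<longleftrightarrow> cring R \<and>
    (\<exists>(D :: 'o ring) P (n :: nat). discrete_valuation_ring D \<and> maximalideal P D \<and>
      R \<simeq> D Quot (P [^]\<^bsub>ideals_set D\<^esub> n))"

text \<open>
  The module \<open>Hom(V, W)\<close>. Its elements are made extensional (equal to \<open>undefined\<close> off \<open>carrier V\<close>),
  so that each homomorphism is represented exactly once; this is needed since averages over
  \<open>Hom(W, R)\<close> are formed. The fields \<open>mult\<close> and \<open>one\<close> have no meaning for modules.
\<close>

definition hom_module ::
  "('r, 'x) ring_scheme \<Rightarrow> ('r, 'v, 'y) module_scheme \<Rightarrow> ('r, 'w, 'z) module_scheme \<Rightarrow>
    ('r, 'v \<Rightarrow> 'w) module"
  where "hom_module R V W =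
    \<lparr>carrier = module_hom R V W \<inter> extensional (carrier V),
     monoid.mult = (\<lambda>f g. \<lambda>x\<in>carrier V. \<zero>\<^bsub>W\<^esub>),
     one = (\<lambda>x\<in>carrier V. \<zero>\<^bsub>W\<^esub>),
     zero = (\<lambda>x\<in>carrier V. \<zero>\<^bsub>W\<^esub>),
     add = (\<lambda>f g. \<lambda>x\<in>carrier V. f x \<oplus>\<^bsub>W\<^esub> g x),
     smult = (\<lambda>r f. \<lambda>x\<in>carrier V. r \<odot>\<^bsub>W\<^esub> f x)\<rparr>"

definition regular_module :: "('r, 'x) ring_scheme \<Rightarrow> ('r, 'r) module"
  where "regular_module R =
    \<lparr>carrier = carrier R, monoid.mult = monoid.mult R, one = \<one>\<^bsub>R\<^esub>, zero = \<zero>\<^bsub>R\<^esub>,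
     add = add R, smult = monoid.mult R\<rparr>"

definition dual_module ::
  "('r, 'x) ring_scheme \<Rightarrow> ('r, 'u, 'y) module_scheme \<Rightarrow> ('r, 'u \<Rightarrow> 'r) module"
  where "dual_module R U = hom_module R U (regular_module R)"

text \<open>For a module representation \<open>\<theta>\<close>, the product \<open>x * a\<close> of \<open>x\<close> in \<open>V\<close> and \<open>a\<close> in \<open>M\<close> is \<open>\<theta> a x\<close>.\<close>

definition module_rep ::
  "('r, 'x) ring_scheme \<Rightarrow> ('r, 'm, 'y1) module_scheme \<Rightarrow> ('r, 'v, 'y2) module_scheme \<Rightarrow>
    ('r, 'w, 'y3) module_scheme \<Rightarrow> ('m \<Rightarrow> 'v \<Rightarrow> 'w) \<Rightarrow> bool"
  where "module_rep R M V W \<theta> \<longleftrightarrow>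
    module R M \<and> module R V \<and> module R W \<and> \<theta> \<in> module_hom R M (hom_module R V W)"

definition ask_pow ::
  "nat \<Rightarrow> ('r, 'm, 'y1) module_scheme \<Rightarrow> ('r, 'v, 'y2) module_scheme \<Rightarrow>
    ('r, 'w, 'y3) module_scheme \<Rightarrow> ('m \<Rightarrow> 'v \<Rightarrow> 'w) \<Rightarrow> real"
  where "ask_pow m M V W \<theta> =
    1 / real (card (carrier M)) * (\<Sum>a\<in>carrier M. real (card (a_kernel V W (\<theta> a))) ^ m)"

abbreviation ask ::
  "('r, 'm, 'y1) module_scheme \<Rightarrow> ('r, 'v, 'y2) module_scheme \<Rightarrow>
    ('r, 'w, 'y3) module_scheme \<Rightarrow> ('m \<Rightarrow> 'v \<Rightarrow> 'w) \<Rightarrow> real"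
  where "ask \<equiv> ask_pow 1"

definition bullet_dual ::
  "('r, 'm, 'y1) module_scheme \<Rightarrow> ('r, 'v, 'y2) module_scheme \<Rightarrow> ('m \<Rightarrow> 'v \<Rightarrow> 'w) \<Rightarrow>
    ('w \<Rightarrow> 'r) \<Rightarrow> 'v \<Rightarrow> 'm \<Rightarrow> 'r"
  where "bullet_dual M V \<theta> = (\<lambda>\<psi>. \<lambda>x\<in>carrier V. \<lambda>a\<in>carrier M. \<psi> (\<theta> a x))"

text \<open>In \<open>alternating_hull\<close>, the first argument \<open>(x', a')\<close> is the parameter and the second argument
  \<open>(x, a)\<close> is the vector it is applied to.\<close>

definition alternating_hull ::
  "('r, 'm, 'y1) module_scheme \<Rightarrow> ('r, 'v, 'y2) module_scheme \<Rightarrow> ('r, 'w, 'y3) module_scheme \<Rightarrow>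
    ('m \<Rightarrow> 'v \<Rightarrow> 'w) \<Rightarrow> 'v \<times> 'm \<Rightarrow> 'v \<times> 'm \<Rightarrow> 'w"
  where "alternating_hull M V W \<theta> =
    (\<lambda>(x', a'). \<lambda>(x, a)\<in>carrier (direct_sum V M). \<theta> a' x \<ominus>\<^bsub>W\<^esub> \<theta> a x')"

lemma module_hom_module:
  assumes V: "module R V" and W: "module R W"
  shows "module R (hom_module R V W)"
proof -
  interpret V: module R V by fact
  interpret W: module R W by fact
  show ?thesis
  proof (rule moduleI)
    show "cring R" by (rule V.R.cring_axioms)
    show "abelian_group (hom_module R V W)"
    proof (rule abelian_groupI, goal_cases)
      case (6 f)
      show ?case
        by (rule bexI[of _ "\<lambda>x\<in>carrier V. \<ominus>\<^bsub>W\<^esub> f x"])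
          (use 6 in \<open>auto simp: hom_module_def module_hom_def Pi_iff W.M.l_neg W.M.minus_add
             W.smult_r_minus intro!: ext\<close>)
    qed (auto simp: hom_module_def module_hom_def Pi_iff W.M.a_ac W.smult_r_distr extensional_def
          intro!: ext)
  qed (auto simp: hom_module_def module_hom_def Pi_iff W.M.a_ac W.smult_r_distr W.smult_l_distr
        W.smult_assoc1[symmetric] V.R.m_comm extensional_def intro!: ext)
qed

lemma module_regular_module:
  assumes "cring R"
  shows "module R (regular_module R)"
proof -
  interpret cring R by fact
  show ?thesis
    by (intro moduleI abelian_groupI cring_axioms)
      (auto simp: regular_module_def a_ac m_assoc l_distr r_distr intro: bexI[of _ "\<ominus>\<^bsub>R\<^esub> _"] l_neg)
qed

lemma module_dual_module: "module R U \<Longrightarrow> module R (dual_module R U)"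
  by (simp add: dual_module_def module_hom_module module_regular_module module.axioms(1))

lemma module_rep_bullet_dual:
  assumes "module_rep R M V W \<theta>"
  shows "module_rep R (dual_module R W) V (dual_module R M) (bullet_dual M V \<theta>)"
proof -
  interpret M: module R M using assms by (simp add: module_rep_def)
  interpret V: module R V using assms by (simp add: module_rep_def)
  interpret W: module R W using assms by (simp add: module_rep_def)
  show ?thesis
    using assms unfolding module_rep_def
    by (auto simp: module_dual_module) 
      (auto simp: dual_module_def hom_module_def regular_module_def bullet_dual_def module_hom_def
        Pi_iff intro!: ext)
qed

lemma module_rep_alternating_hull:
  assumes "module_rep R M V W \<theta>"
  shows "module_rep R (direct_sum V M) (direct_sum V M) W (alternating_hull M V W \<theta>)"
proof -
  interpret M: module R M using assms by (simp add: module_rep_def)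
  interpret V: module R V using assms by (simp add: module_rep_def)
  interpret W: module R W using assms by (simp add: module_rep_def)
  show ?thesis
    using assms unfolding module_rep_def
    by (auto simp: direct_sum_is_module)
      (auto simp: hom_module_def alternating_hull_def direct_sum_def module_hom_def
        Pi_iff a_minus_def W.M.a_ac W.M.minus_add W.smult_r_distr W.smult_r_minus intro!: ext)
qed

end

theory Submission
  imports Defs
begin

text \<open>
  Fix \<open>x\<close> and \<open>x'\<close> in \<open>V\<close> and consider the homomorphism \<open>M \<oplus> M \<rightarrow> W\<close> taking \<open>(a, a')\<close> to
  \<open>x * a' - x' * a\<close>; write \<open>K(x, x')\<close> for its kernel and \<open>N(x, x')\<close> for its image. The sum of the
  kernel sizes of the alternating hull counts the quadruples \<open>(x, a, x', a')\<close> with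
  \<open>x * a' = x' * a\<close>, so it is the sum of \<open>|K(x, x')|\<close> over all pairs \<open>(x, x')\<close>. On the other side,
  \<open>|Ker \<psi>|\<^sup>2\<close> for \<open>\<psi>\<close> in \<open>W\<^sup>*\<close>, viewed as an element of \<open>Hom(V, M\<^sup>*)\<close>, counts the pairs \<open>(x, x')\<close>
  such that \<open>\<psi>\<close> kills both \<open>x * M\<close> and \<open>x' * M\<close>, that is, kills \<open>N(x, x')\<close>. Hence the sum of these
  squares is the sum of \<open>|N(x, x')\<^sup>\<bottom>|\<close> over all pairs, where \<open>N\<^sup>\<bottom>\<close> is the set of functionals in
  \<open>W\<^sup>*\<close> that vanish on \<open>N\<close>. The two sums are compared term by term through
  \<open>|K(x, x')| |N(x, x')| = |M|\<^sup>2\<close> and \<open>|N\<^sup>\<bottom>| |N| = |W|\<close>; the latter, for \<open>N = 0\<close>, also gives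
  \<open>|W\<^sup>*| = |W|\<close>.

  The identity \<open>|N\<^sup>\<bottom>| |N| = |W|\<close> (lemma \<open>card_functionals_vanishing\<close>) is where the ring enters. It
  expresses that \<open>R\<close> is injective over itself and that each cyclic module has as many functionals as
  elements. Two properties of \<open>R\<close> suffice: every ideal is principal, and every principal ideal
  equals its double annihilator. Any quotient of a principal ideal domain by a nonzero ideal has
  both of them (lemma \<open>principal_quasi_frobenius_ring_image\<close>), in particular any truncated discrete
  valuation ring.
\<close>

section \<open>Kernels and images of homomorphisms\<close>

lemma (in group_hom) card_kernel_times_card_image:
  assumes "finite (carrier G)"
  shows "card (kernel G H h) * card (h ` carrier G) = card (carrier G)"
proof -
  let ?K = "kernel G H h"
  have img: "h ` (?K #>\<^bsub>G\<^esub> g) = {h g}" if "g \<in> carrier G" for g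
    using that G.one_closed by (force simp: r_coset_def kernel_def image_iff)
  have "bij_betw (\<lambda>X. the_elem (h ` X)) (rcosets\<^bsub>G\<^esub> ?K) (h ` carrier G)"
  proof (rule bij_betw_imageI)
    show "inj_on (\<lambda>X. the_elem (h ` X)) (rcosets\<^bsub>G\<^esub> ?K)"
      using FactGroup_inj_on by (simp add: FactGroup_def)
    have "(\<lambda>X. the_elem (h ` X)) ` (rcosets\<^bsub>G\<^esub> ?K)
        = (\<lambda>g. the_elem (h ` (?K #>\<^bsub>G\<^esub> g))) ` carrier G"
      by (auto simp: RCOSETS_def)
    also have "\<dots> = h ` carrier G"
      by (rule image_cong) (simp_all add: img)
    finally show "(\<lambda>X. the_elem (h ` X)) ` (rcosets\<^bsub>G\<^esub> ?K) = h ` carrier G" .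
  qed
  then have "card (rcosets\<^bsub>G\<^esub> ?K) = card (h ` carrier G)"
    by (rule bij_betw_same_card)
  with G.lagrange_finite[OF assms subgroup_kernel] show ?thesis
    by (simp add: order_def mult.commute)
qed

lemma card_kernel_times_card_image_module_hom:
  assumes "module R A" "module R B" "f \<in> module_hom R A B" "finite (carrier A)"
  shows "card (a_kernel A B f) * card (f ` carrier A) = card (carrier A)"
proof -
  interpret A: module R A by fact
  interpret B: module R B by fact
  interpret group_hom "add_monoid A" "add_monoid B" f
    by (intro group_hom.intro A.add.group_axioms B.add.group_axioms group_hom_axioms.intro)
      (use assms(3) in \<open>auto simp: hom_def module_hom_def\<close>)
  show ?thesis
    using card_kernel_times_card_image assms(4) by (simp add: a_kernel_def)
qed

section \<open>Truncated discrete valuation rings as quasi-Frobenius rings\<close>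

text \<open>The second axiom says that the annihilator of the annihilator of \<open>t\<close> is no larger than the
  ideal generated by \<open>t\<close>. It is exactly what is needed to extend a functional given on the ideal
  generated by \<open>t\<close> to all of \<open>R\<close>, so with principal ideals it amounts to Baer's criterion for \<open>R\<close>
  as a module over itself. A domain satisfies it only if it is a field.\<close>

locale principal_quasi_frobenius_ring = cring R for R (structure) +
  assumes ideal_principal: "ideal I R \<Longrightarrow> \<exists>t\<in>carrier R. I = PIdl t"
    and divides_if_annihilated:
      "\<lbrakk>t \<in> carrier R; c \<in> carrier R; \<And>s. s \<in> carrier R \<Longrightarrow> s \<otimes> t = \<zero> \<Longrightarrow> s \<otimes> c = \<zero>\<rbrakk>
        \<Longrightarrow> \<exists>d\<in>carrier R. c = d \<otimes> t"

text \<open>The ring \<open>R\<close> is a quotient \<open>D/(p)\<close>. For the double annihilator property, let \<open>t'\<close> and \<open>c'\<close> be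
  lifts of \<open>t\<close> and \<open>c\<close>, let \<open>g\<close> be a greatest common divisor of \<open>t'\<close> and \<open>p\<close>, and write \<open>p = s g\<close>.
  Then \<open>s\<close> annihilates \<open>t\<close> in \<open>R\<close>, hence also \<open>c\<close>, so \<open>s g\<close> divides \<open>s c'\<close> and \<open>g\<close> divides \<open>c'\<close>. But
  \<open>g\<close> lies in the ideal generated by \<open>t'\<close> and \<open>p\<close>, so modulo \<open>p\<close> it is a multiple of \<open>t\<close>.
  Cancelling \<open>s\<close> is legitimate because \<open>p \<noteq> 0\<close>.\<close>

lemma principal_quasi_frobenius_ring_image:
  fixes D (structure)
  assumes "principal_domain D" and "cring R" and "\<phi> \<in> ring_hom D R"
    and surj: "\<phi> ` carrier D = carrier R"
    and p: "p \<in> carrier D" "p \<noteq> \<zero>" and ker: "a_kernel D R \<phi> = PIdl p"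
  shows "principal_quasi_frobenius_ring R"
proof -
  interpret D: principal_domain D by fact
  interpret R: cring R by fact
  interpret hom: ring_hom_ring D R \<phi>
    using assms(3) by (intro ring_hom_ring.intro ring_hom_ring_axioms.intro
        D.ring_axioms R.ring_axioms)
  have ker_iff: "\<phi> x = \<zero>\<^bsub>R\<^esub> \<longleftrightarrow> (\<exists>y\<in>carrier D. x = y \<otimes> p)" if "x \<in> carrier D" for x
  proof -
    have "\<phi> x = \<zero>\<^bsub>R\<^esub> \<longleftrightarrow> x \<in> PIdl p"
      unfolding ker[symmetric] a_kernel_def' using that by blast
    then show ?thesis
      unfolding cgenideal_def by blast
  qed
  have lift: "\<exists>x'\<in>carrier D. x = \<phi> x'" if "x \<in> carrier R" for x
    using surj that by auto
  show ?thesis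
  proof (unfold_locales)
    fix I assume I: "ideal I R"
    then obtain g where g: "g \<in> carrier D" "{x \<in> carrier D. \<phi> x \<in> I} = PIdl g"
      using D.exists_gen[OF hom.ideal_vimage] by blast
    have "I = PIdl\<^bsub>R\<^esub> \<phi> g"
    proof (intro equalityI subsetI)
      fix y assume y: "y \<in> I"
      then obtain x where x: "x \<in> carrier D" "y = \<phi> x"
        using lift ideal.Icarr[OF I] by blast
      with y g obtain z where "z \<in> carrier D" "x = z \<otimes> g"
        unfolding cgenideal_def by blast
      with x g(1) show "y \<in> PIdl\<^bsub>R\<^esub> \<phi> g"
        by (auto simp: cgenideal_def)
    next
      fix y assume "y \<in> PIdl\<^bsub>R\<^esub> \<phi> g"
      moreover have "\<phi> g \<in> I"
        using D.cgenideal_self[OF g(1)] unfolding g(2)[symmetric] by simp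
      ultimately show "y \<in> I"
        by (auto simp: cgenideal_def ideal.I_l_closed[OF I])
    qed
    with g(1) show "\<exists>t\<in>carrier R. I = PIdl\<^bsub>R\<^esub> t"
      by (intro bexI[of _ "\<phi> g"]) simp_all
  next
    fix t c
    assume t: "t \<in> carrier R" and c: "c \<in> carrier R"
      and ann: "\<And>s. s \<in> carrier R \<Longrightarrow> s \<otimes>\<^bsub>R\<^esub> t = \<zero>\<^bsub>R\<^esub> \<Longrightarrow> s \<otimes>\<^bsub>R\<^esub> c = \<zero>\<^bsub>R\<^esub>"
    obtain t' c' where t': "t' \<in> carrier D" "t = \<phi> t'" and c': "c' \<in> carrier D" "c = \<phi> c'"
      using lift t c by meson
    obtain g where g: "g \<in> carrier D" "PIdl t' <+>\<^bsub>D\<^esub> PIdl p = PIdl g"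
      using D.exists_gen[OF D.add_ideals[OF D.cgenideal_ideal[OF t'(1)] D.cgenideal_ideal[OF p(1)]]]
      by blast
    have "t' \<in> PIdl t' <+>\<^bsub>D\<^esub> PIdl p" "p \<in> PIdl t' <+>\<^bsub>D\<^esub> PIdl p"
    proof -
      have "t' = t' \<oplus> \<zero>" "p = \<zero> \<oplus> p"
        using t' p by simp_all
      moreover have "\<zero> \<in> PIdl t'" "\<zero> \<in> PIdl p"
        using t' p by (simp_all add: additive_subgroup.zero_closed D.cgenideal_ideal ideal.axioms(1))
      ultimately show "t' \<in> PIdl t' <+>\<^bsub>D\<^esub> PIdl p" "p \<in> PIdl t' <+>\<^bsub>D\<^esub> PIdl p"
        using D.cgenideal_self[OF t'(1)] D.cgenideal_self[OF p(1)]
        unfolding set_add_def' by blast+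
    qed
    then have "t' \<in> PIdl g" "p \<in> PIdl g"
      unfolding g(2) .
    then obtain u s where u: "u \<in> carrier D" "t' = u \<otimes> g" and s: "s \<in> carrier D" "p = s \<otimes> g"
      unfolding cgenideal_def by blast
    have "\<phi> s \<otimes>\<^bsub>R\<^esub> t = \<phi> (s \<otimes> t')"
      using t' s(1) by simp
    also have "s \<otimes> t' = u \<otimes> p"
      unfolding u(2) s(2) using s(1) u(1) g(1) by (rule D.m_lcomm)
    also have "\<phi> (u \<otimes> p) = \<zero>\<^bsub>R\<^esub>"
      using ker_iff[of "u \<otimes> p"] u(1) p(1) by blast
    finally have "\<phi> s \<otimes>\<^bsub>R\<^esub> c = \<zero>\<^bsub>R\<^esub>"
      using ann s(1) by simp
    then have "\<phi> (s \<otimes> c') = \<zero>\<^bsub>R\<^esub>"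
      unfolding c'(2) using s(1) c'(1) by simp
    then obtain m where m: "m \<in> carrier D" "s \<otimes> c' = m \<otimes> p"
      using ker_iff[of "s \<otimes> c'"] s(1) c'(1) by blast
    have "s \<otimes> c' = s \<otimes> (m \<otimes> g)"
      unfolding m(2) unfolding s(2) using m(1) s(1) g(1) by (simp add: D.m_lcomm)
    moreover have "s \<noteq> \<zero>"
      using s p g(1) by auto
    ultimately have c'_eq: "c' = m \<otimes> g"
      using s(1) c'(1) m(1) g(1) D.m_lcancel by simp
    have "g \<in> PIdl t' <+>\<^bsub>D\<^esub> PIdl p"
      unfolding g(2) using g(1) by (rule D.cgenideal_self)
    then obtain a b where ab: "a \<in> carrier D" "b \<in> carrier D" and g_eq: "g = a \<otimes> t' \<oplus> b \<otimes> p"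
      unfolding set_add_def' cgenideal_def by blast
    have "\<phi> (b \<otimes> p) = \<zero>\<^bsub>R\<^esub>"
      using ker_iff[of "b \<otimes> p"] ab p(1) by blast
    moreover have "\<phi> g = \<phi> (a \<otimes> t') \<oplus>\<^bsub>R\<^esub> \<phi> (b \<otimes> p)"
      unfolding g_eq using ab t'(1) p(1) by (intro hom.hom_add) simp_all
    ultimately have "\<phi> g = \<phi> a \<otimes>\<^bsub>R\<^esub> t"
      unfolding t'(2) using ab t'(1) by simp
    then have "c = (\<phi> m \<otimes>\<^bsub>R\<^esub> \<phi> a) \<otimes>\<^bsub>R\<^esub> t"
      unfolding c'(2) c'_eq using m(1) g(1) ab t by (simp add: R.m_assoc)
    then show "\<exists>d\<in>carrier R. c = d \<otimes>\<^bsub>R\<^esub> t"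
      using m(1) ab by (intro bexI[of _ "\<phi> m \<otimes>\<^bsub>R\<^esub> \<phi> a"]) simp_all
  qed
qed

text \<open>The product of nonzero elements of two ideals is
  a nonzero element of their product.\<close>

lemma (in domain) ideal_power_nonzero:
  assumes "ideal P R" "P \<noteq> {\<zero>}"
  shows "ideal (P [^]\<^bsub>ideals_set R\<^esub> (n::nat)) R \<and> P [^]\<^bsub>ideals_set R\<^esub> n \<noteq> {\<zero>}"
proof (induction n)
  case 0
  have "carrier R \<noteq> {\<zero>}"
    using one_not_zero one_closed by blast
  then show ?case
    by (simp add: ideals_set_def nat_pow_def oneideal)
next
  case (Suc n)
  have Suc_eq: "P [^]\<^bsub>ideals_set R\<^esub> Suc n = ideal_prod R (P [^]\<^bsub>ideals_set R\<^esub> n) P"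
    by (simp add: nat_pow_def) (simp add: ideals_set_def)
  have nonzero: "\<exists>x\<in>I. x \<noteq> \<zero>" if "ideal I R" "I \<noteq> {\<zero>}" for I
    using that additive_subgroup.zero_closed[OF ideal.axioms(1)] by blast
  obtain x y where xy: "x \<in> P [^]\<^bsub>ideals_set R\<^esub> n" "x \<noteq> \<zero>" "y \<in> P" "y \<noteq> \<zero>"
    using nonzero Suc assms by meson
  have "x \<otimes> y \<noteq> \<zero>"
    using xy Suc assms by (meson ideal.Icarr integral)
  moreover have "x \<otimes> y \<in> ideal_prod R (P [^]\<^bsub>ideals_set R\<^esub> n) P"
    using xy by (intro ideal_prod.prod)
  ultimately show ?case
    unfolding Suc_eq using Suc assms ideal_prod_is_ideal by auto
qed

text \<open>The maximal ideal of a discrete valuation ring is nonzero, because the ring is not a field;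
  hence all its powers are nonzero, and \<open>R\<close> is a quotient of a principal ideal domain by a nonzero
  ideal.\<close>

lemma truncated_dvr_imp_principal_quasi_frobenius_ring:
  fixes R :: "('r, 'x) ring_scheme"
  assumes "truncated_dvr TYPE('o) R"
  shows "principal_quasi_frobenius_ring R"
proof -
  obtain D :: "'o ring" and P :: "'o set" and n :: nat
    where D: "discrete_valuation_ring D" and P: "maximalideal P D"
      and iso: "R \<simeq> D Quot (P [^]\<^bsub>ideals_set D\<^esub> n)" and R: "cring R"
    using assms unfolding truncated_dvr_def by blast
  interpret D: principal_domain D
    using D by (simp add: discrete_valuation_ring_def)
  interpret R: cring R by fact
  define J where "J = P [^]\<^bsub>ideals_set D\<^esub> n"
  have "P \<noteq> {\<zero>\<^bsub>D\<^esub>}"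
    using D P D.zeromaximalideal_eq_field by (auto simp: discrete_valuation_ring_def)
  then have J: "ideal J D" "J \<noteq> {\<zero>\<^bsub>D\<^esub>}"
    using D.ideal_power_nonzero P unfolding J_def by (auto simp: maximalideal_def)
  obtain p where p: "p \<in> carrier D" "J = PIdl\<^bsub>D\<^esub> p"
    using D.exists_gen[OF J(1)] by blast
  have "p \<noteq> \<zero>\<^bsub>D\<^esub>"
    using J(2) p D.cgenideal_eq_genideal D.genideal_zero by auto
  obtain \<psi> where \<psi>: "\<psi> \<in> ring_iso (D Quot J) R"
    using ring_iso_sym[OF R.ring_axioms iso] unfolding is_ring_iso_def J_def by blast
  interpret J: ideal J D by fact
  interpret quot: ring "D Quot J"
    by (rule J.quotient_is_ring)
  have hom: "\<psi> \<in> ring_hom (D Quot J) R" and bij: "bij_betw \<psi> (carrier (D Quot J)) (carrier R)"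
    using \<psi> by (auto simp: ring_iso_def)
  interpret \<psi>: ring_hom_ring "D Quot J" R \<psi>
    by (intro ring_hom_ring.intro ring_hom_ring_axioms.intro quot.ring_axioms R.ring_axioms hom)
  have carr: "carrier (D Quot J) = (\<lambda>x. J +>\<^bsub>D\<^esub> x) ` carrier D"
    by (auto simp: FactRing_def A_RCOSETS_def')
  show ?thesis
  proof (rule principal_quasi_frobenius_ring_image)
    show "\<psi> \<circ> (+>\<^bsub>D\<^esub>) J \<in> ring_hom D R"
      by (rule ring_hom_trans[OF J.rcos_ring_hom hom])
    show "(\<psi> \<circ> (+>\<^bsub>D\<^esub>) J) ` carrier D = carrier R"
      using bij unfolding carr bij_betw_def by (simp add: image_comp)
    have "\<psi> (J +>\<^bsub>D\<^esub> x) = \<zero>\<^bsub>R\<^esub> \<longleftrightarrow> x \<in> J" if "x \<in> carrier D" for x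
    proof -
      have "\<psi> (J +>\<^bsub>D\<^esub> x) = \<zero>\<^bsub>R\<^esub> \<longleftrightarrow> J +>\<^bsub>D\<^esub> x = \<zero>\<^bsub>D Quot J\<^esub>"
        using bij carr that quot.zero_closed \<psi>.hom_zero
        by (metis bij_betw_imp_inj_on imageI inj_on_eq_iff)
      also have "\<dots> \<longleftrightarrow> x \<in> J"
        using that J.rcos_const_imp_mem J.a_rcos_const by (auto simp: FactRing_def)
      finally show ?thesis .
    qed
    then show "a_kernel D R (\<psi> \<circ> (+>\<^bsub>D\<^esub>) J) = PIdl\<^bsub>D\<^esub> p"
      unfolding a_kernel_def' comp_def p(2)[symmetric] using J.Icarr by blast
  qed (rule D.principal_domain_axioms R p(1) \<open>p \<noteq> \<zero>\<^bsub>D\<^esub>\<close>)+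
qed

section \<open>Functionals on a finite module that vanish on a submodule\<close>

text \<open>The functionals live on a submodule \<open>H\<close> of \<open>W\<close> rather than on \<open>W\<close> itself, so that they can be
  counted by letting \<open>H\<close> grow from \<open>N\<close> to \<open>W\<close>. Asking them to vanish on \<open>N\<close> replaces a passage to
  the quotient module \<open>H/N\<close>.\<close>

definition functionals_vanishing ::
  "('r, 'x) ring_scheme \<Rightarrow> ('r, 'w, 'y) module_scheme \<Rightarrow> 'w set \<Rightarrow> 'w set \<Rightarrow> ('w \<Rightarrow> 'r) set"
  where "functionals_vanishing R W H N =
    {f \<in> carrier (dual_module R (W\<lparr>carrier := H\<rparr>)). \<forall>y\<in>N. f y = \<zero>\<^bsub>R\<^esub>}"

lemma functionals_vanishing_iff:
  "f \<in> functionals_vanishing R W H N \<longleftrightarrow>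
    f \<in> H \<rightarrow> carrier R \<and> f \<in> extensional H \<and>
    (\<forall>x\<in>H. \<forall>y\<in>H. f (x \<oplus>\<^bsub>W\<^esub> y) = f x \<oplus>\<^bsub>R\<^esub> f y) \<and>
    (\<forall>r\<in>carrier R. \<forall>x\<in>H. f (r \<odot>\<^bsub>W\<^esub> x) = r \<otimes>\<^bsub>R\<^esub> f x) \<and> (\<forall>y\<in>N. f y = \<zero>\<^bsub>R\<^esub>)"
  unfolding functionals_vanishing_def dual_module_def hom_module_def regular_module_def module_hom_def
  by auto

definition adjoin :: "('r, 'x) ring_scheme \<Rightarrow> ('r, 'w, 'y) module_scheme \<Rightarrow> 'w set \<Rightarrow> 'w \<Rightarrow> 'w set"
  where "adjoin R W H w = {h \<oplus>\<^bsub>W\<^esub> r \<odot>\<^bsub>W\<^esub> w | h r. h \<in> H \<and> r \<in> carrier R}"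

context module
begin

lemma submodule_zero: "Module.submodule H R M \<Longrightarrow> \<zero>\<^bsub>M\<^esub> \<in> H"
  using Module.submodule.axioms(1) subgroup.one_closed by fastforce

lemma adjoin_swap:
  assumes "h \<in> carrier M" "r \<in> carrier R" "h' \<in> carrier M" "r' \<in> carrier R" "w \<in> carrier M"
  shows "(h \<oplus>\<^bsub>M\<^esub> r \<odot>\<^bsub>M\<^esub> w) \<oplus>\<^bsub>M\<^esub> (h' \<oplus>\<^bsub>M\<^esub> r' \<odot>\<^bsub>M\<^esub> w) = (h \<oplus>\<^bsub>M\<^esub> h') \<oplus>\<^bsub>M\<^esub> (r \<oplus> r') \<odot>\<^bsub>M\<^esub> w"
  using assms by (simp add: smult_l_distr M.a_ac)

lemma smult_adjoin:
  assumes "h \<in> carrier M" "r \<in> carrier R" "s \<in> carrier R" "w \<in> carrier M"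
  shows "s \<odot>\<^bsub>M\<^esub> (h \<oplus>\<^bsub>M\<^esub> r \<odot>\<^bsub>M\<^esub> w) = s \<odot>\<^bsub>M\<^esub> h \<oplus>\<^bsub>M\<^esub> (s \<otimes> r) \<odot>\<^bsub>M\<^esub> w"
  using assms by (simp add: smult_r_distr smult_assoc1)

lemma submodule_adjoin:
  assumes H: "Module.submodule H R M" and w: "w \<in> carrier M"
  shows "Module.submodule (adjoin R M H w) R M" and "H \<subseteq> adjoin R M H w" and "w \<in> adjoin R M H w"
proof -
  note HE = submoduleE[OF H]
  have elt: "\<exists>h r. y = h \<oplus>\<^bsub>M\<^esub> r \<odot>\<^bsub>M\<^esub> w \<and> h \<in> H \<and> h \<in> carrier M \<and> r \<in> carrier R"
    if "y \<in> adjoin R M H w" for y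
    using that HE(1) by (auto simp: adjoin_def)
  have I: "h \<oplus>\<^bsub>M\<^esub> r \<odot>\<^bsub>M\<^esub> w \<in> adjoin R M H w" if "h \<in> H" "r \<in> carrier R" for h r
    using that by (auto simp: adjoin_def)
  have incl: "h \<oplus>\<^bsub>M\<^esub> \<zero> \<odot>\<^bsub>M\<^esub> w = h" if "h \<in> H" for h
    using that HE(1) w by (auto simp: smult_l_null)
  show sub: "H \<subseteq> adjoin R M H w"
    using I[OF _ R.zero_closed] incl by fastforce
  show "w \<in> adjoin R M H w"
    using I[OF submodule_zero[OF H] R.one_closed] w by simp
  have smult: "s \<odot>\<^bsub>M\<^esub> y \<in> adjoin R M H w" if s: "s \<in> carrier R" and y: "y \<in> adjoin R M H w" for s y
  proof -
    obtain h r where "y = h \<oplus>\<^bsub>M\<^esub> r \<odot>\<^bsub>M\<^esub> w" "h \<in> H" "h \<in> carrier M" "r \<in> carrier R"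
      using elt y by blast
    then show ?thesis
      using smult_adjoin[of h r s w] w s I[of "s \<odot>\<^bsub>M\<^esub> h" "s \<otimes> r"] HE(4) by simp
  qed
  have carr: "adjoin R M H w \<subseteq> carrier M"
    using elt w by fastforce
  show "Module.submodule (adjoin R M H w) R M"
  proof (rule submoduleI)
    show "\<zero>\<^bsub>M\<^esub> \<in> adjoin R M H w"
      using sub submodule_zero[OF H] by blast
    fix y assume y: "y \<in> adjoin R M H w"
    have "\<ominus>\<^bsub>M\<^esub> y = (\<ominus> \<one>) \<odot>\<^bsub>M\<^esub> y"
      using y carr by (simp add: smult_l_minus subset_iff)
    then show "\<ominus>\<^bsub>M\<^esub> y \<in> adjoin R M H w"
      using smult[OF _ y] by simp
    fix z assume z: "z \<in> adjoin R M H w"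
    obtain h r where 1: "y = h \<oplus>\<^bsub>M\<^esub> r \<odot>\<^bsub>M\<^esub> w" "h \<in> H" "h \<in> carrier M" "r \<in> carrier R"
      using elt y by blast
    obtain h' r' where 2: "z = h' \<oplus>\<^bsub>M\<^esub> r' \<odot>\<^bsub>M\<^esub> w" "h' \<in> H" "h' \<in> carrier M" "r' \<in> carrier R"
      using elt z by blast
    show "y \<oplus>\<^bsub>M\<^esub> z \<in> adjoin R M H w"
      unfolding 1(1) 2(1) adjoin_swap[OF 1(3,4) 2(3,4) w] using 1 2 HE(5) by (intro I) auto
  qed (use carr smult in auto)
qed

lemma ideal_conductor:
  assumes H: "Module.submodule H R M" and w: "w \<in> carrier M"
  shows "ideal {r \<in> carrier R. r \<odot>\<^bsub>M\<^esub> w \<in> H} R"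
proof (rule idealI)
  note HE = submoduleE[OF H]
  show "ring R" by (rule R.ring_axioms)
  show "subgroup {r \<in> carrier R. r \<odot>\<^bsub>M\<^esub> w \<in> H} (add_monoid R)"
  proof (rule R.add.subgroupI)
    have "\<zero> \<in> {r \<in> carrier R. r \<odot>\<^bsub>M\<^esub> w \<in> H}"
      using submodule_zero[OF H] w by (simp add: smult_l_null)
    then show "{r \<in> carrier R. r \<odot>\<^bsub>M\<^esub> w \<in> H} \<noteq> {}" by blast
    fix a assume "a \<in> {r \<in> carrier R. r \<odot>\<^bsub>M\<^esub> w \<in> H}"
    then show "\<ominus> a \<in> {r \<in> carrier R. r \<odot>\<^bsub>M\<^esub> w \<in> H}"
      using w HE(3) by (simp add: smult_l_minus)
  qed (use w HE(5) in \<open>auto simp: smult_l_distr\<close>)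
  fix a x assume "a \<in> {r \<in> carrier R. r \<odot>\<^bsub>M\<^esub> w \<in> H}" "x \<in> carrier R"
  then show "x \<otimes> a \<in> {r \<in> carrier R. r \<odot>\<^bsub>M\<^esub> w \<in> H}"
    using w HE(4) by (simp add: smult_assoc1)
  then show "a \<otimes> x \<in> {r \<in> carrier R. r \<odot>\<^bsub>M\<^esub> w \<in> H}"
    using \<open>a \<in> _\<close> \<open>x \<in> _\<close> by (simp add: R.m_comm)
qed


text \<open>Apply the kernel-image formula to \<open>H \<oplus> R \<rightarrow> M\<close>, \<open>(h, r) \<mapsto> h + r w\<close>. A pair in the kernel is
  determined by \<open>r\<close>, which may be any scalar with \<open>r w \<in> H\<close>.\<close>

lemma card_adjoin:
  assumes H: "Module.submodule H R M" and w: "w \<in> carrier M"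
    and fin: "finite (carrier R)" "finite (carrier M)"
  shows "card (adjoin R M H w) * card {r \<in> carrier R. r \<odot>\<^bsub>M\<^esub> w \<in> H} = card H * card (carrier R)"
proof -
  note HE = submoduleE[OF H]
  have M: "module R M" by (rule module_axioms)
  let ?A = "direct_sum (M\<lparr>carrier := H\<rparr>) (regular_module R)"
  let ?f = "\<lambda>(h, r). h \<oplus>\<^bsub>M\<^esub> r \<odot>\<^bsub>M\<^esub> w"
  have A: "module R ?A"
    by (intro direct_sum_is_module Module.submodule.submodule_is_module[OF H M]
        module_regular_module R.cring_axioms)
  have carrA: "carrier ?A = H \<times> carrier R"
    by (simp add: direct_sum_def regular_module_def)
  have HM: "h \<in> carrier M" if "h \<in> H" for h
    using that HE(1) by blast
  have "?f \<in> module_hom R ?A M"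
    unfolding module_hom_def
    by (auto simp: direct_sum_def regular_module_def HM w adjoin_swap smult_adjoin)
  from card_kernel_times_card_image_module_hom[OF A M this]
  have "card (a_kernel ?A M ?f) * card (?f ` (H \<times> carrier R)) = card (H \<times> carrier R)"
    using fin finite_subset[OF HE(1)] by (simp add: carrA)
  moreover have "?f ` (H \<times> carrier R) = adjoin R M H w"
    unfolding adjoin_def by force
  moreover have "card (a_kernel ?A M ?f) = card {r \<in> carrier R. r \<odot>\<^bsub>M\<^esub> w \<in> H}"
  proof (rule bij_betw_same_card[of snd], rule bij_betw_byWitness[where f' = "\<lambda>r. (\<ominus>\<^bsub>M\<^esub> (r \<odot>\<^bsub>M\<^esub> w), r)"])
    have *: "h = \<ominus>\<^bsub>M\<^esub> (r \<odot>\<^bsub>M\<^esub> w)" "r \<odot>\<^bsub>M\<^esub> w = \<ominus>\<^bsub>M\<^esub> h"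
      if "h \<in> H" "r \<in> carrier R" "h \<oplus>\<^bsub>M\<^esub> r \<odot>\<^bsub>M\<^esub> w = \<zero>\<^bsub>M\<^esub>" for h r
      using that HM w M.minus_equality M.minus_minus smult_closed by metis+
    show "\<forall>x\<in>a_kernel ?A M ?f. (\<ominus>\<^bsub>M\<^esub> (snd x \<odot>\<^bsub>M\<^esub> w), snd x) = x"
      using *(1) by (auto simp: a_kernel_def' carrA)
    show "snd ` a_kernel ?A M ?f \<subseteq> {r \<in> carrier R. r \<odot>\<^bsub>M\<^esub> w \<in> H}"
    proof (rule image_subsetI)
      fix x assume "x \<in> a_kernel ?A M ?f"
      then show "snd x \<in> {r \<in> carrier R. r \<odot>\<^bsub>M\<^esub> w \<in> H}"
        using *(2)[of "fst x" "snd x"] HE(3)[of "fst x"] by (auto simp: a_kernel_def' carrA)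
    qed
    show "(\<lambda>r. (\<ominus>\<^bsub>M\<^esub> (r \<odot>\<^bsub>M\<^esub> w), r)) ` {r \<in> carrier R. r \<odot>\<^bsub>M\<^esub> w \<in> H} \<subseteq> a_kernel ?A M ?f"
      using HE(3) w by (auto simp: a_kernel_def' carrA M.l_neg)
  qed simp
  ultimately show ?thesis
    by (simp add: card_cartesian_product mult.commute)
qed

end

text \<open>Multiplication by \<open>t\<close> has the ideal generated by \<open>t\<close> as image and the annihilator of \<open>t\<close> as
  kernel.\<close>

lemma (in cring) card_cgenideal_times_card_annihilator:
  assumes "finite (carrier R)" "t \<in> carrier R"
  shows "card (PIdl t) * card {d \<in> carrier R. t \<otimes> d = \<zero>} = card (carrier R)"
proof -
  have "module R (regular_module R)"
    by (rule module_regular_module[OF cring_axioms])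
  moreover have "(\<lambda>d. d \<otimes> t) \<in> module_hom R (regular_module R) (regular_module R)"
    using assms(2) by (auto simp: module_hom_def regular_module_def l_distr m_assoc)
  moreover have "a_kernel (regular_module R) (regular_module R) (\<lambda>d. d \<otimes> t) = {d \<in> carrier R. t \<otimes> d = \<zero>}"
    using assms(2) by (auto simp: a_kernel_def' regular_module_def m_comm)
  moreover have "(\<lambda>d. d \<otimes> t) ` carrier R = PIdl t"
    by (auto simp: cgenideal_def)
  ultimately show ?thesis
    using card_kernel_times_card_image_module_hom[of R "regular_module R" "regular_module R" "\<lambda>d. d \<otimes> t"]
      assms(1) by (simp add: regular_module_def mult.commute)
qed

locale module_over_principal_quasi_frobenius_ring =
  module R M + principal_quasi_frobenius_ring R for R :: "('r, 'x) ring_scheme" and M :: "('r, 'm, 'y) module_scheme" (structure)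
begin

text \<open>A functional \<open>f\<close> on \<open>H\<close> is extended to \<open>H + R w\<close> by choosing its value \<open>d\<close> at \<open>w\<close>. The choice is
  consistent as soon as it agrees with \<open>f\<close> on the multiples of \<open>w\<close> that lie in \<open>H\<close>; these are the
  multiples of \<open>t w\<close>, so the only condition is \<open>t d = f (t w)\<close>.\<close>

lemma functional_extends:
  assumes H: "Module.submodule H R M" and N: "N \<subseteq> H" and w: "w \<in> carrier M"
    and t: "t \<in> carrier R" "{r \<in> carrier R. r \<odot>\<^bsub>M\<^esub> w \<in> H} = PIdl\<^bsub>R\<^esub> t"
    and f: "f \<in> functionals_vanishing R M H N"
    and d: "d \<in> carrier R" "t \<otimes>\<^bsub>R\<^esub> d = f (t \<odot>\<^bsub>M\<^esub> w)"
  shows "\<exists>g \<in> functionals_vanishing R M (adjoin R M H w) N. restrict g H = f \<and> g w = d"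
proof -
  note HE = submoduleE[OF H]
  have HM: "h \<in> carrier M" if "h \<in> H" for h
    using that HE(1) by blast
  have fR: "f h \<in> carrier R" if "h \<in> H" for h
    using f that by (auto simp: functionals_vanishing_iff)
  have fadd: "f (h \<oplus>\<^bsub>M\<^esub> h') = f h \<oplus>\<^bsub>R\<^esub> f h'" if "h \<in> H" "h' \<in> H" for h h'
    using f that by (auto simp: functionals_vanishing_iff)
  have fsmult: "f (r \<odot>\<^bsub>M\<^esub> h) = r \<otimes>\<^bsub>R\<^esub> f h" if "r \<in> carrier R" "h \<in> H" for r h
    using f that by (auto simp: functionals_vanishing_iff)
  have tH: "t \<odot>\<^bsub>M\<^esub> w \<in> H"
    using R.cgenideal_self[OF t(1)] unfolding t(2)[symmetric] by simp
  \<comment> \<open>Every \<open>r\<close> with \<open>r w \<in> H\<close> is a multiple of \<open>t\<close>, so the condition on \<open>d\<close> propagates from \<open>t\<close>.\<close>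
  have cond: "f (r \<odot>\<^bsub>M\<^esub> w) = r \<otimes>\<^bsub>R\<^esub> d" if r: "r \<in> carrier R" "r \<odot>\<^bsub>M\<^esub> w \<in> H" for r
  proof -
    have "r \<in> PIdl\<^bsub>R\<^esub> t"
      unfolding t(2)[symmetric] using r by simp
    then obtain s where s: "s \<in> carrier R" and r_eq: "r = s \<otimes>\<^bsub>R\<^esub> t"
      unfolding cgenideal_def by blast
    have "f (r \<odot>\<^bsub>M\<^esub> w) = s \<otimes>\<^bsub>R\<^esub> f (t \<odot>\<^bsub>M\<^esub> w)"
      unfolding r_eq using s t(1) w tH by (simp add: smult_assoc1 fsmult)
    also have "\<dots> = r \<otimes>\<^bsub>R\<^esub> d"
      unfolding r_eq d(2)[symmetric] using s t(1) d(1) by (simp add: R.m_assoc)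
    finally show ?thesis .
  qed
  have welldef: "f h \<oplus>\<^bsub>R\<^esub> r \<otimes>\<^bsub>R\<^esub> d = f h' \<oplus>\<^bsub>R\<^esub> r' \<otimes>\<^bsub>R\<^esub> d"
    if h: "h \<in> H" "h' \<in> H" and r: "r \<in> carrier R" "r' \<in> carrier R"
      and eq: "h \<oplus>\<^bsub>M\<^esub> r \<odot>\<^bsub>M\<^esub> w = h' \<oplus>\<^bsub>M\<^esub> r' \<odot>\<^bsub>M\<^esub> w" for h h' r r'
  proof -
    have "(r \<ominus>\<^bsub>R\<^esub> r') \<odot>\<^bsub>M\<^esub> w = r \<odot>\<^bsub>M\<^esub> w \<ominus>\<^bsub>M\<^esub> r' \<odot>\<^bsub>M\<^esub> w"
      using r w by (simp add: a_minus_def smult_l_distr smult_l_minus)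
    also have "\<dots> = (\<ominus>\<^bsub>M\<^esub> h \<oplus>\<^bsub>M\<^esub> (h \<oplus>\<^bsub>M\<^esub> r \<odot>\<^bsub>M\<^esub> w)) \<ominus>\<^bsub>M\<^esub> r' \<odot>\<^bsub>M\<^esub> w"
      using r w h HM by (simp add: M.r_neg1)
    also have "\<dots> = \<ominus>\<^bsub>M\<^esub> h \<oplus>\<^bsub>M\<^esub> h'"
      unfolding eq using r w h HM by (simp add: a_minus_def M.a_assoc M.r_neg)
    finally have diff: "(r \<ominus>\<^bsub>R\<^esub> r') \<odot>\<^bsub>M\<^esub> w = \<ominus>\<^bsub>M\<^esub> h \<oplus>\<^bsub>M\<^esub> h'" .
    have mem: "\<ominus>\<^bsub>M\<^esub> h \<oplus>\<^bsub>M\<^esub> h' \<in> H"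
      using h HE(3,5) by blast
    have "h' = h \<oplus>\<^bsub>M\<^esub> (\<ominus>\<^bsub>M\<^esub> h \<oplus>\<^bsub>M\<^esub> h')"
      using h HM by (simp add: M.r_neg2)
    then have "f h' = f h \<oplus>\<^bsub>R\<^esub> f (\<ominus>\<^bsub>M\<^esub> h \<oplus>\<^bsub>M\<^esub> h')"
      using fadd[OF h(1) mem] by simp
    also have "f (\<ominus>\<^bsub>M\<^esub> h \<oplus>\<^bsub>M\<^esub> h') = (r \<ominus>\<^bsub>R\<^esub> r') \<otimes>\<^bsub>R\<^esub> d"
      using cond[of "r \<ominus>\<^bsub>R\<^esub> r'"] r mem by (simp add: diff)
    finally have "f h' \<oplus>\<^bsub>R\<^esub> r' \<otimes>\<^bsub>R\<^esub> d = f h \<oplus>\<^bsub>R\<^esub> ((r \<ominus>\<^bsub>R\<^esub> r') \<otimes>\<^bsub>R\<^esub> d \<oplus>\<^bsub>R\<^esub> r' \<otimes>\<^bsub>R\<^esub> d)"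
      using fR h r d(1) by (simp add: R.a_assoc)
    also have "(r \<ominus>\<^bsub>R\<^esub> r') \<otimes>\<^bsub>R\<^esub> d \<oplus>\<^bsub>R\<^esub> r' \<otimes>\<^bsub>R\<^esub> d = r \<otimes>\<^bsub>R\<^esub> d"
      using r d(1) by (simp add: R.l_distr[symmetric] a_minus_def R.a_assoc R.l_neg)
    finally show ?thesis by simp
  qed
  define g where "g = (\<lambda>y\<in>adjoin R M H w.
    THE z. \<exists>h\<in>H. \<exists>r\<in>carrier R. y = h \<oplus>\<^bsub>M\<^esub> r \<odot>\<^bsub>M\<^esub> w \<and> z = f h \<oplus>\<^bsub>R\<^esub> r \<otimes>\<^bsub>R\<^esub> d)"
  have g: "g (h \<oplus>\<^bsub>M\<^esub> r \<odot>\<^bsub>M\<^esub> w) = f h \<oplus>\<^bsub>R\<^esub> r \<otimes>\<^bsub>R\<^esub> d" if "h \<in> H" "r \<in> carrier R" for h r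
  proof -
    have "h \<oplus>\<^bsub>M\<^esub> r \<odot>\<^bsub>M\<^esub> w \<in> adjoin R M H w"
      using that unfolding adjoin_def by blast
    then have "g (h \<oplus>\<^bsub>M\<^esub> r \<odot>\<^bsub>M\<^esub> w) = (THE z. \<exists>h'\<in>H. \<exists>r'\<in>carrier R.
        h \<oplus>\<^bsub>M\<^esub> r \<odot>\<^bsub>M\<^esub> w = h' \<oplus>\<^bsub>M\<^esub> r' \<odot>\<^bsub>M\<^esub> w \<and> z = f h' \<oplus>\<^bsub>R\<^esub> r' \<otimes>\<^bsub>R\<^esub> d)"
      by (simp only: g_def restrict_apply')
    also have "\<dots> = f h \<oplus>\<^bsub>R\<^esub> r \<otimes>\<^bsub>R\<^esub> d"
    proof (rule the_equality)
      show "\<exists>h'\<in>H. \<exists>r'\<in>carrier R. h \<oplus>\<^bsub>M\<^esub> r \<odot>\<^bsub>M\<^esub> w = h' \<oplus>\<^bsub>M\<^esub> r' \<odot>\<^bsub>M\<^esub> w \<and>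
          f h \<oplus>\<^bsub>R\<^esub> r \<otimes>\<^bsub>R\<^esub> d = f h' \<oplus>\<^bsub>R\<^esub> r' \<otimes>\<^bsub>R\<^esub> d"
        using that by (intro bexI[of _ h] bexI[of _ r]) simp_all
    next
      fix z assume "\<exists>h'\<in>H. \<exists>r'\<in>carrier R. h \<oplus>\<^bsub>M\<^esub> r \<odot>\<^bsub>M\<^esub> w = h' \<oplus>\<^bsub>M\<^esub> r' \<odot>\<^bsub>M\<^esub> w \<and>
          z = f h' \<oplus>\<^bsub>R\<^esub> r' \<otimes>\<^bsub>R\<^esub> d"
      then obtain h' r' where "h' \<in> H" "r' \<in> carrier R"
          "h \<oplus>\<^bsub>M\<^esub> r \<odot>\<^bsub>M\<^esub> w = h' \<oplus>\<^bsub>M\<^esub> r' \<odot>\<^bsub>M\<^esub> w" "z = f h' \<oplus>\<^bsub>R\<^esub> r' \<otimes>\<^bsub>R\<^esub> d"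
        by blast
      then show "z = f h \<oplus>\<^bsub>R\<^esub> r \<otimes>\<^bsub>R\<^esub> d"
        using welldef[of h h' r r'] that by simp
    qed
    finally show ?thesis .
  qed
  have elt: "\<exists>h r. y = h \<oplus>\<^bsub>M\<^esub> r \<odot>\<^bsub>M\<^esub> w \<and> h \<in> H \<and> r \<in> carrier R" if "y \<in> adjoin R M H w" for y
    using that unfolding adjoin_def by blast
  have g_H: "g h = f h" if "h \<in> H" for h
    using g[OF that R.zero_closed] that HM fR w d(1) by (simp add: smult_l_null)
  have "g w = f \<zero>\<^bsub>M\<^esub> \<oplus>\<^bsub>R\<^esub> d"
    using g[OF submodule_zero[OF H] R.one_closed] w d(1) by simp
  moreover have "f \<zero>\<^bsub>M\<^esub> = \<zero>\<^bsub>R\<^esub>"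
    using fsmult[OF R.zero_closed submodule_zero[OF H]] fR[OF submodule_zero[OF H]] by simp
  ultimately have g_w: "g w = d"
    using d(1) by simp
  have "g \<in> functionals_vanishing R M (adjoin R M H w) N"
    unfolding functionals_vanishing_iff
  proof (intro conjI ballI funcsetI)
    fix y assume y: "y \<in> adjoin R M H w"
    then obtain h r where 1: "y = h \<oplus>\<^bsub>M\<^esub> r \<odot>\<^bsub>M\<^esub> w" "h \<in> H" "r \<in> carrier R"
      using elt by blast
    then show "g y \<in> carrier R"
      using g fR d(1) by simp
    fix z assume z: "z \<in> adjoin R M H w"
    then obtain h' r' where 2: "z = h' \<oplus>\<^bsub>M\<^esub> r' \<odot>\<^bsub>M\<^esub> w" "h' \<in> H" "r' \<in> carrier R"
      using elt by blast
    have "g (y \<oplus>\<^bsub>M\<^esub> z) = f (h \<oplus>\<^bsub>M\<^esub> h') \<oplus>\<^bsub>R\<^esub> (r \<oplus>\<^bsub>R\<^esub> r') \<otimes>\<^bsub>R\<^esub> d"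
      unfolding 1(1) 2(1) adjoin_swap[OF HM[OF 1(2)] 1(3) HM[OF 2(2)] 2(3) w]
      using 1 2 HE(5) by (intro g) auto
    also have "\<dots> = (f h \<oplus>\<^bsub>R\<^esub> r \<otimes>\<^bsub>R\<^esub> d) \<oplus>\<^bsub>R\<^esub> (f h' \<oplus>\<^bsub>R\<^esub> r' \<otimes>\<^bsub>R\<^esub> d)"
      using 1(2,3) 2(2,3) fR d(1) by (simp add: fadd R.l_distr R.a_ac)
    also have "\<dots> = g y \<oplus>\<^bsub>R\<^esub> g z"
      unfolding 1(1) 2(1) g[OF 1(2,3)] g[OF 2(2,3)] ..
    finally show "g (y \<oplus>\<^bsub>M\<^esub> z) = g y \<oplus>\<^bsub>R\<^esub> g z" .
  next
    fix s y assume s: "s \<in> carrier R" and y: "y \<in> adjoin R M H w"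
    then obtain h r where 1: "y = h \<oplus>\<^bsub>M\<^esub> r \<odot>\<^bsub>M\<^esub> w" "h \<in> H" "r \<in> carrier R"
      using elt by blast
    have "g (s \<odot>\<^bsub>M\<^esub> y) = f (s \<odot>\<^bsub>M\<^esub> h) \<oplus>\<^bsub>R\<^esub> (s \<otimes>\<^bsub>R\<^esub> r) \<otimes>\<^bsub>R\<^esub> d"
      unfolding 1(1) smult_adjoin[OF HM[OF 1(2)] 1(3) s w]
      using 1 s HE(4) by (intro g) auto
    also have "\<dots> = s \<otimes>\<^bsub>R\<^esub> g y"
      unfolding 1(1) g[OF 1(2,3)] using 1(2,3) s fR d(1)
      by (simp add: fsmult R.r_distr R.m_assoc)
    finally show "g (s \<odot>\<^bsub>M\<^esub> y) = s \<otimes>\<^bsub>R\<^esub> g y" .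
  next
    show "g \<in> extensional (adjoin R M H w)"
      by (simp add: g_def)
    fix y assume "y \<in> N"
    then show "g y = \<zero>\<^bsub>R\<^esub>"
      using N g_H f by (auto simp: functionals_vanishing_iff)
  qed
  moreover have "restrict g H = f"
    using f g_H by (intro extensionalityI[of _ H]) (auto simp: functionals_vanishing_iff)
  ultimately show ?thesis
    using g_w by blast
qed

text \<open>An extension \<open>g\<close> of \<open>f\<close> is determined by \<open>d = g w\<close>, which ranges over the solutions of
  \<open>t d = f (t w)\<close>. A scalar that annihilates \<open>t\<close> also annihilates \<open>f (t w)\<close>, so the double annihilator
  property provides a solution, and the set of all solutions is a coset of the annihilator of \<open>t\<close>.\<close>

lemma card_functionals_vanishing_adjoin:
  assumes H: "Module.submodule H R M" and N: "N \<subseteq> H" and w: "w \<in> carrier M"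
    and t: "t \<in> carrier R" "{r \<in> carrier R. r \<odot>\<^bsub>M\<^esub> w \<in> H} = PIdl\<^bsub>R\<^esub> t"
    and fin: "finite (carrier R)" "finite (carrier M)"
  shows "card (functionals_vanishing R M (adjoin R M H w) N) =
    card (functionals_vanishing R M H N) * card {d \<in> carrier R. t \<otimes>\<^bsub>R\<^esub> d = \<zero>\<^bsub>R\<^esub>}"
proof -
  note HE = submoduleE[OF H]
  note adj = submodule_adjoin[OF H w]
  let ?Ann = "{d \<in> carrier R. t \<otimes>\<^bsub>R\<^esub> d = \<zero>\<^bsub>R\<^esub>}"
  let ?E = "\<lambda>f. {d \<in> carrier R. t \<otimes>\<^bsub>R\<^esub> d = f (t \<odot>\<^bsub>M\<^esub> w)}"
  have tH: "t \<odot>\<^bsub>M\<^esub> w \<in> H"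
    using R.cgenideal_self[OF t(1)] unfolding t(2)[symmetric] by simp
  have finH: "finite H"
    using HE(1) fin(2) by (rule finite_subset)
  have finD: "finite (functionals_vanishing R M H N)"
    by (rule finite_subset[OF _ finite_PiE[OF finH, of "\<lambda>_. carrier R"]])
      (auto simp: functionals_vanishing_iff PiE_def fin(1))
  have cardE: "card (?E f) = card ?Ann" if f: "f \<in> functionals_vanishing R M H N" for f
  proof -
    have fR: "f (t \<odot>\<^bsub>M\<^esub> w) \<in> carrier R"
      using f tH by (auto simp: functionals_vanishing_iff)
    have "\<exists>d\<in>carrier R. f (t \<odot>\<^bsub>M\<^esub> w) = d \<otimes>\<^bsub>R\<^esub> t"
    proof (rule divides_if_annihilated[OF t(1) fR])
      fix s assume s: "s \<in> carrier R" "s \<otimes>\<^bsub>R\<^esub> t = \<zero>\<^bsub>R\<^esub>"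
      have "s \<otimes>\<^bsub>R\<^esub> f (t \<odot>\<^bsub>M\<^esub> w) = f ((s \<otimes>\<^bsub>R\<^esub> t) \<odot>\<^bsub>M\<^esub> w)"
        using f s(1) tH t(1) w by (simp add: functionals_vanishing_iff smult_assoc1)
      also have "\<dots> = f (\<zero>\<^bsub>R\<^esub> \<odot>\<^bsub>M\<^esub> (t \<odot>\<^bsub>M\<^esub> w))"
        using s t(1) w by (simp add: smult_l_null)
      also have "\<dots> = \<zero>\<^bsub>R\<^esub>"
        using f tH fR by (simp add: functionals_vanishing_iff)
      finally show "s \<otimes>\<^bsub>R\<^esub> f (t \<odot>\<^bsub>M\<^esub> w) = \<zero>\<^bsub>R\<^esub>" .
    qed
    then obtain d0 where d0: "d0 \<in> carrier R" "f (t \<odot>\<^bsub>M\<^esub> w) = t \<otimes>\<^bsub>R\<^esub> d0"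
      using t(1) R.m_comm by metis
    have "bij_betw (\<lambda>d. d0 \<oplus>\<^bsub>R\<^esub> d) ?Ann (?E f)"
    proof (rule bij_betw_byWitness[where f' = "\<lambda>d. \<ominus>\<^bsub>R\<^esub> d0 \<oplus>\<^bsub>R\<^esub> d"])
      show "(\<lambda>d. d0 \<oplus>\<^bsub>R\<^esub> d) ` ?Ann \<subseteq> ?E f"
        using d0(1) t(1) by (auto simp: d0(2) R.r_distr)
      show "(\<lambda>d. \<ominus>\<^bsub>R\<^esub> d0 \<oplus>\<^bsub>R\<^esub> d) ` ?E f \<subseteq> ?Ann"
        using d0(1) t(1) by (auto simp: d0(2) R.r_distr R.r_minus R.l_neg)
    qed (use d0(1) in \<open>auto simp: R.r_neg1 R.r_neg2\<close>)
    then show ?thesis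
      by (rule bij_betw_same_card[symmetric])
  qed
  have "bij_betw (\<lambda>g. (restrict g H, g w)) (functionals_vanishing R M (adjoin R M H w) N)
    (Sigma (functionals_vanishing R M H N) ?E)"
  proof (rule bij_betw_imageI)
    show "inj_on (\<lambda>g. (restrict g H, g w)) (functionals_vanishing R M (adjoin R M H w) N)"
    proof (rule inj_onI)
      fix g g' assume g: "g \<in> functionals_vanishing R M (adjoin R M H w) N"
        and g': "g' \<in> functionals_vanishing R M (adjoin R M H w) N"
        and eq: "(restrict g H, g w) = (restrict g' H, g' w)"
      have ext: "k (h \<oplus>\<^bsub>M\<^esub> r \<odot>\<^bsub>M\<^esub> w) = restrict k H h \<oplus>\<^bsub>R\<^esub> r \<otimes>\<^bsub>R\<^esub> k w"
        if k: "k \<in> functionals_vanishing R M (adjoin R M H w) N" and h: "h \<in> H" and r: "r \<in> carrier R"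
        for k h r
      proof -
        have "h \<in> adjoin R M H w" "r \<odot>\<^bsub>M\<^esub> w \<in> adjoin R M H w"
          using adj h r submoduleE(4)[OF adj(1)] by auto
        then show ?thesis
          using k h r adj(3) by (simp add: functionals_vanishing_iff)
      qed
      show "g = g'"
      proof (rule extensionalityI[of _ "adjoin R M H w"])
        fix y assume "y \<in> adjoin R M H w"
        then obtain h r where y: "y = h \<oplus>\<^bsub>M\<^esub> r \<odot>\<^bsub>M\<^esub> w" and "h \<in> H" "r \<in> carrier R"
          unfolding adjoin_def by blast
        then have "g y = restrict g H h \<oplus>\<^bsub>R\<^esub> r \<otimes>\<^bsub>R\<^esub> g w"
          "g' y = restrict g' H h \<oplus>\<^bsub>R\<^esub> r \<otimes>\<^bsub>R\<^esub> g' w"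
          using ext[OF g] ext[OF g'] by (simp_all only: y)
        with eq show "g y = g' y"
          by (simp only: prod.inject)
      qed (use g g' in \<open>auto simp: functionals_vanishing_iff\<close>)
    qed
    show "(\<lambda>g. (restrict g H, g w)) ` functionals_vanishing R M (adjoin R M H w) N
        = Sigma (functionals_vanishing R M H N) ?E"
    proof (intro equalityI subsetI)
      fix z assume "z \<in> (\<lambda>g. (restrict g H, g w)) ` functionals_vanishing R M (adjoin R M H w) N"
      then obtain g where z: "z = (restrict g H, g w)"
        and g: "g \<in> functionals_vanishing R M (adjoin R M H w) N"
        by blast
      have "restrict g H \<in> functionals_vanishing R M H N"
        using g adj(2) N HE(4,5) unfolding functionals_vanishing_iff
        by (auto simp: subset_iff Pi_iff)
      moreover have "g w \<in> ?E (restrict g H)"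
        using g adj(3) t(1) tH by (auto simp: functionals_vanishing_iff)
      ultimately show "z \<in> Sigma (functionals_vanishing R M H N) ?E"
        using z by simp
    next
      fix z assume "z \<in> Sigma (functionals_vanishing R M H N) ?E"
      then obtain f d where z: "z = (f, d)" and f: "f \<in> functionals_vanishing R M H N"
        and d: "d \<in> carrier R" "t \<otimes>\<^bsub>R\<^esub> d = f (t \<odot>\<^bsub>M\<^esub> w)"
        by blast
      show "z \<in> (\<lambda>g. (restrict g H, g w)) ` functionals_vanishing R M (adjoin R M H w) N"
        using functional_extends[OF H N w t f d] z by force
    qed
  qed
  then have "card (functionals_vanishing R M (adjoin R M H w) N)
      = card (Sigma (functionals_vanishing R M H N) ?E)"
    by (rule bij_betw_same_card)
  also have "\<dots> = (\<Sum>f\<in>functionals_vanishing R M H N. card (?E f))"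
    using finD fin(1) by (intro card_SigmaI) auto
  also have "\<dots> = card (functionals_vanishing R M H N) * card ?Ann"
    using cardE by simp
  finally show ?thesis .
qed

text \<open>Take a largest submodule \<open>H\<close> between \<open>N\<close> and \<open>M\<close> for which the formula holds; \<open>H = N\<close> is a
  candidate. If \<open>H\<close> missed an element \<open>w\<close>, let \<open>t\<close> generate the ideal of all \<open>r\<close> with \<open>r w \<in> H\<close>.
  Passing from \<open>H\<close> to \<open>H + R w\<close> multiplies the number of functionals as well as the number of
  elements by the size of the annihilator of \<open>t\<close>, so the formula would hold for a larger
  submodule.\<close>

lemma card_functionals_vanishing:
  assumes N: "Module.submodule N R M" and fin: "finite (carrier R)" "finite (carrier M)"
  shows "card (functionals_vanishing R M (carrier M) N) * card N = card (carrier M)"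
proof -
  let ?good = "\<lambda>H. Module.submodule H R M \<and> N \<subseteq> H \<and> card (functionals_vanishing R M H N) * card N = card H"
  \<comment> \<open>Only the zero map is left for \<open>H = N\<close>; it is extensional, so it is a single function.\<close>
  have "functionals_vanishing R M N N = {\<lambda>x\<in>N. \<zero>\<^bsub>R\<^esub>}"
    using submoduleE(4,5)[OF N] by (auto simp: functionals_vanishing_iff intro!: extensionalityI[of _ N])
  then have "?good N"
    using N by simp
  moreover have "H \<subseteq> carrier M" if "?good H" for H
    using that submoduleE(1) by blast
  then have "card H < Suc (card (carrier M))" if "?good H" for H
    using that card_mono[OF fin(2)] by (meson le_imp_less_Suc)
  ultimately obtain H where good: "?good H" and max: "\<And>H'. ?good H' \<Longrightarrow> card H' \<le> card H"
    using ex_has_greatest_nat[of ?good N card "Suc (card (carrier M))"] by blast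
  have H: "Module.submodule H R M" and NH: "N \<subseteq> H"
    using good by blast+
  have "H = carrier M"
  proof (rule ccontr)
    assume "H \<noteq> carrier M"
    then obtain w where w: "w \<in> carrier M" "w \<notin> H"
      using submoduleE(1)[OF H] by blast
    note adj = submodule_adjoin[OF H w(1)]
    obtain t where t: "t \<in> carrier R" "{r \<in> carrier R. r \<odot>\<^bsub>M\<^esub> w \<in> H} = PIdl\<^bsub>R\<^esub> t"
      using ideal_principal[OF ideal_conductor[OF H w(1)]] by blast
    \<comment> \<open>By \<open>card_adjoin\<close>, the index of \<open>H\<close> in \<open>H + R w\<close> is that of the ideal of \<open>t\<close> in \<open>R\<close>, which is \<open>?a\<close>.\<close>
    let ?a = "card {d \<in> carrier R. t \<otimes>\<^bsub>R\<^esub> d = \<zero>\<^bsub>R\<^esub>}"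
    have "card (adjoin R M H w) * card (PIdl\<^bsub>R\<^esub> t) = card H * ?a * card (PIdl\<^bsub>R\<^esub> t)"
      using card_adjoin[OF H w(1) fin] R.card_cgenideal_times_card_annihilator[OF fin(1) t(1)]
      by (simp add: t(2) mult_ac)
    moreover have "card (PIdl\<^bsub>R\<^esub> t) \<noteq> 0"
      using R.card_cgenideal_times_card_annihilator[OF fin(1) t(1)] fin(1) R.zero_closed
      by (metis card_eq_0_iff empty_iff mult_is_0)
    ultimately have "card (adjoin R M H w) = card H * ?a"
      by simp
    then have "?good (adjoin R M H w)"
      using adj NH good card_functionals_vanishing_adjoin[OF H NH w(1) t fin]
      by (auto simp: mult_ac)
    then have "card (adjoin R M H w) \<le> card H"
      by (rule max)
    then have "H = adjoin R M H w"
      using adj fin submoduleE(1)[OF adj(1)] by (meson card_seteq finite_subset)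
    then show False
      using adj(3) w(2) by blast
  qed
  then show ?thesis
    using good by blast
qed

end

section \<open>Counting zeros of the alternating hull\<close>

lemma card_eq_sum_of_bool: "finite A \<Longrightarrow> real (card {x \<in> A. P x}) = (\<Sum>x\<in>A. of_bool (P x))"
  by (simp add: Int_def)

text \<open>The product of the alternating hull as a function of the two components in \<open>M\<close>, with both
  vectors fixed. In this form it is a homomorphism on \<open>M \<oplus> M\<close>.\<close>

definition bracket :: "('r, 'w, 'y) module_scheme \<Rightarrow> ('m \<Rightarrow> 'v \<Rightarrow> 'w) \<Rightarrow> 'v \<Rightarrow> 'v \<Rightarrow> 'm \<times> 'm \<Rightarrow> 'w"
  where "bracket W \<theta> x x' = (\<lambda>(a, a'). \<theta> a' x \<ominus>\<^bsub>W\<^esub> \<theta> a x')"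

lemma (in module) submodule_image_module_hom:
  assumes A: "module R A" and f: "f \<in> module_hom R A M"
  shows "Module.submodule (f ` carrier A) R M"
proof (rule submoduleI)
  interpret A: module R A by fact
  have carr: "f y \<in> carrier M" if "y \<in> carrier A" for y
    using f that by (auto simp: module_hom_def)
  have add: "f y \<oplus>\<^bsub>M\<^esub> f z = f (y \<oplus>\<^bsub>A\<^esub> z)" if "y \<in> carrier A" "z \<in> carrier A" for y z
    using f that by (simp add: module_hom_def)
  have smult: "r \<odot>\<^bsub>M\<^esub> f y = f (r \<odot>\<^bsub>A\<^esub> y)" if "r \<in> carrier R" "y \<in> carrier A" for r y
    using f that by (simp add: module_hom_def)
  show "f ` carrier A \<subseteq> carrier M"
    using carr by blast
  have smult_mem: "r \<odot>\<^bsub>M\<^esub> y \<in> f ` carrier A" if "r \<in> carrier R" "y \<in> f ` carrier A" for r y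
    using that smult A.smult_closed by blast
  then show "r \<odot>\<^bsub>M\<^esub> y \<in> f ` carrier A" if "r \<in> carrier R" "y \<in> f ` carrier A" for r y
    using that .
  have "\<zero> \<odot>\<^bsub>M\<^esub> f \<zero>\<^bsub>A\<^esub> \<in> f ` carrier A"
    by (rule smult_mem) simp_all
  then show "\<zero>\<^bsub>M\<^esub> \<in> f ` carrier A"
    using carr by (simp add: smult_l_null)
  fix y assume y: "y \<in> f ` carrier A"
  have "(\<ominus> \<one>) \<odot>\<^bsub>M\<^esub> y \<in> f ` carrier A"
    using y by (intro smult_mem) simp_all
  then show "\<ominus>\<^bsub>M\<^esub> y \<in> f ` carrier A"
    using y carr by (auto simp: smult_l_minus)
  fix z assume "z \<in> f ` carrier A"
  with y show "y \<oplus>\<^bsub>M\<^esub> z \<in> f ` carrier A"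
    using add A.M.a_closed by auto
qed

lemma module_repD:
  assumes "module_rep R M V W \<theta>"
  shows "\<lbrakk>a \<in> carrier M; x \<in> carrier V\<rbrakk> \<Longrightarrow> \<theta> a x \<in> carrier W"
    and "\<lbrakk>a \<in> carrier M; b \<in> carrier M; x \<in> carrier V\<rbrakk> \<Longrightarrow> \<theta> (a \<oplus>\<^bsub>M\<^esub> b) x = \<theta> a x \<oplus>\<^bsub>W\<^esub> \<theta> b x"
    and "\<lbrakk>r \<in> carrier R; a \<in> carrier M; x \<in> carrier V\<rbrakk> \<Longrightarrow> \<theta> (r \<odot>\<^bsub>M\<^esub> a) x = r \<odot>\<^bsub>W\<^esub> \<theta> a x"
  using assms by (auto simp: module_rep_def module_hom_def hom_module_def)

lemma bracket_module_hom:
  assumes \<theta>: "module_rep R M V W \<theta>" and x: "x \<in> carrier V" "x' \<in> carrier V"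
  shows "bracket W \<theta> x x' \<in> module_hom R (direct_sum M M) W"
proof -
  interpret M: module R M using \<theta> by (simp add: module_rep_def)
  interpret W: module R W using \<theta> by (simp add: module_rep_def)
  note D = module_repD[OF \<theta>]
  show ?thesis
    unfolding module_hom_def
    by (auto simp: bracket_def direct_sum_def D x a_minus_def W.M.minus_add W.M.a_ac
        W.smult_r_distr W.smult_r_minus)
qed

lemma a_kernel_bullet_dual:
  "a_kernel V (dual_module R M) (bullet_dual M V \<theta> \<psi>) =
    {x \<in> carrier V. \<forall>a\<in>carrier M. \<psi> (\<theta> a x) = \<zero>\<^bsub>R\<^esub>}"
proof -
  have "restrict f (carrier M) = restrict g (carrier M) \<longleftrightarrow> (\<forall>a\<in>carrier M. f a = g a)" for f g
    by (auto simp: restrict_def fun_eq_iff)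
  then show ?thesis
    by (auto simp: a_kernel_def' bullet_dual_def dual_module_def hom_module_def regular_module_def)
qed

lemma dual_moduleD:
  assumes "\<psi> \<in> carrier (dual_module R W)"
  shows "y \<in> carrier W \<Longrightarrow> \<psi> y \<in> carrier R"
    and "\<lbrakk>y \<in> carrier W; z \<in> carrier W\<rbrakk> \<Longrightarrow> \<psi> (y \<oplus>\<^bsub>W\<^esub> z) = \<psi> y \<oplus>\<^bsub>R\<^esub> \<psi> z"
    and "\<lbrakk>r \<in> carrier R; y \<in> carrier W\<rbrakk> \<Longrightarrow> \<psi> (r \<odot>\<^bsub>W\<^esub> y) = r \<otimes>\<^bsub>R\<^esub> \<psi> y"
  using assms by (auto simp: dual_module_def hom_module_def regular_module_def module_hom_def)

lemma dual_module_apply_zero: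
  assumes "module R W" and \<psi>: "\<psi> \<in> carrier (dual_module R W)"
  shows "\<psi> \<zero>\<^bsub>W\<^esub> = \<zero>\<^bsub>R\<^esub>"
proof -
  interpret W: module R W by fact
  have "\<psi> \<zero>\<^bsub>W\<^esub> = \<psi> (\<zero>\<^bsub>R\<^esub> \<odot>\<^bsub>W\<^esub> \<zero>\<^bsub>W\<^esub>)"
    by (simp add: W.smult_l_null)
  also have "\<dots> = \<zero>\<^bsub>R\<^esub> \<otimes>\<^bsub>R\<^esub> \<psi> \<zero>\<^bsub>W\<^esub>"
    by (rule dual_moduleD(3)[OF \<psi>]) simp_all
  also have "\<dots> = \<zero>\<^bsub>R\<^esub>"
    by (simp add: dual_moduleD(1)[OF \<psi>])
  finally show ?thesis .
qed

text \<open>The image of the bracket is \<open>x * M + x' * M\<close>, as is seen by putting one of its two arguments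
  equal to zero.\<close>

lemma vanishes_on_bracket_iff:
  assumes \<theta>: "module_rep R M V W \<theta>" and x: "x \<in> carrier V" "x' \<in> carrier V"
    and \<psi>: "\<psi> \<in> carrier (dual_module R W)"
  shows "(\<forall>y\<in>bracket W \<theta> x x' ` (carrier M \<times> carrier M). \<psi> y = \<zero>\<^bsub>R\<^esub>) \<longleftrightarrow>
    (\<forall>a\<in>carrier M. \<psi> (\<theta> a x) = \<zero>\<^bsub>R\<^esub>) \<and> (\<forall>a\<in>carrier M. \<psi> (\<theta> a x') = \<zero>\<^bsub>R\<^esub>)"
proof -
  interpret M: module R M using \<theta> by (simp add: module_rep_def)
  interpret W: module R W using \<theta> by (simp add: module_rep_def)
  note D = module_repD[OF \<theta>]
  note carr = dual_moduleD(1)[OF \<psi>] and add = dual_moduleD(2)[OF \<psi>]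
    and smult = dual_moduleD(3)[OF \<psi>]
  have minus: "\<psi> (\<ominus>\<^bsub>W\<^esub> y) = \<ominus>\<^bsub>R\<^esub> \<psi> y" if "y \<in> carrier W" for y
    using smult[of "\<ominus>\<^bsub>R\<^esub> \<one>\<^bsub>R\<^esub>" y] that carr by (simp add: W.smult_l_minus M.R.l_minus)
  have zero: "\<theta> \<zero>\<^bsub>M\<^esub> y = \<zero>\<^bsub>W\<^esub>" if "y \<in> carrier V" for y
    using D(3)[of "\<zero>\<^bsub>R\<^esub>" "\<zero>\<^bsub>M\<^esub>" y] D(1)[of "\<zero>\<^bsub>M\<^esub>" y] that by (simp add: W.smult_l_null M.smult_l_null)
  have \<psi>_bracket: "\<psi> (bracket W \<theta> x x' (a, a')) = \<psi> (\<theta> a' x) \<oplus>\<^bsub>R\<^esub> \<ominus>\<^bsub>R\<^esub> \<psi> (\<theta> a x')"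
    if "a \<in> carrier M" "a' \<in> carrier M" for a a'
    using that x by (simp add: bracket_def a_minus_def add minus D)
  have \<psi>_zero: "\<psi> (\<theta> \<zero>\<^bsub>M\<^esub> y) = \<zero>\<^bsub>R\<^esub>" if "y \<in> carrier V" for y
    using that by (simp add: zero dual_module_apply_zero[OF W.module_axioms \<psi>])
  show ?thesis
  proof (intro iffI conjI ballI)
    fix a assume *: "\<forall>y\<in>bracket W \<theta> x x' ` (carrier M \<times> carrier M). \<psi> y = \<zero>\<^bsub>R\<^esub>" and a: "a \<in> carrier M"
    have "\<psi> (bracket W \<theta> x x' (\<zero>\<^bsub>M\<^esub>, a)) = \<zero>\<^bsub>R\<^esub>" "\<psi> (bracket W \<theta> x x' (a, \<zero>\<^bsub>M\<^esub>)) = \<zero>\<^bsub>R\<^esub>"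
      using * a by auto
    then show "\<psi> (\<theta> a x) = \<zero>\<^bsub>R\<^esub>" "\<psi> (\<theta> a x') = \<zero>\<^bsub>R\<^esub>"
      using a x carr D(1) by (simp_all add: \<psi>_bracket \<psi>_zero)
  qed (auto simp: \<psi>_bracket)
qed

lemma functionals_vanishing_carrier:
  "functionals_vanishing R W (carrier W) N = {\<psi> \<in> carrier (dual_module R W). \<forall>y\<in>N. \<psi> y = \<zero>\<^bsub>R\<^esub>}"
  by (simp add: functionals_vanishing_def)

text \<open>Both sides count the quadruples \<open>(x, a, x', a')\<close> with \<open>x * a' = x' * a\<close>: the left-hand side
  groups them by \<open>(x', a')\<close>, the right-hand side by \<open>(x, x')\<close>.\<close>

lemma sum_card_kernel_alternating_hull:
  assumes \<theta>: "module_rep R M V W \<theta>" and fin: "finite (carrier M)" "finite (carrier V)"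
  shows "(\<Sum>p\<in>carrier (direct_sum V M). real (card (a_kernel (direct_sum V M) W (alternating_hull M V W \<theta> p)))) =
    (\<Sum>x\<in>carrier V. \<Sum>x'\<in>carrier V. real (card (a_kernel (direct_sum M M) W (bracket W \<theta> x x'))))"
proof -
  let ?P = "\<lambda>x a x' a'. of_bool (bracket W \<theta> x x' (a, a') = \<zero>\<^bsub>W\<^esub>) :: real"
  have carr: "carrier (direct_sum V M) = carrier V \<times> carrier M" "carrier (direct_sum M M) = carrier M \<times> carrier M"
    by (simp_all add: direct_sum_def)
  have 1: "real (card (a_kernel (direct_sum V M) W (alternating_hull M V W \<theta> (x', a')))) =
      (\<Sum>x\<in>carrier V. \<Sum>a\<in>carrier M. ?P x a x' a')" for x' a'
  proof -
    have "a_kernel (direct_sum V M) W (alternating_hull M V W \<theta> (x', a')) =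
      {p \<in> carrier V \<times> carrier M. bracket W \<theta> (fst p) x' (snd p, a') = \<zero>\<^bsub>W\<^esub>}"
      by (auto simp: a_kernel_def' carr alternating_hull_def bracket_def)
    then show ?thesis
      using fin by (simp add: card_eq_sum_of_bool sum.cartesian_product case_prod_unfold
          del: sum_of_bool_eq)
  qed
  have 2: "real (card (a_kernel (direct_sum M M) W (bracket W \<theta> x x'))) =
      (\<Sum>a\<in>carrier M. \<Sum>a'\<in>carrier M. ?P x a x' a')" for x x'
    using fin by (simp add: a_kernel_def' carr card_eq_sum_of_bool sum.cartesian_product case_prod_unfold
          del: sum_of_bool_eq)
  have "(\<Sum>p\<in>carrier (direct_sum V M). real (card (a_kernel (direct_sum V M) W (alternating_hull M V W \<theta> p))))
      = (\<Sum>x'\<in>carrier V. \<Sum>a'\<in>carrier M. \<Sum>x\<in>carrier V. \<Sum>a\<in>carrier M. ?P x a x' a')"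
    unfolding 1[symmetric] by (simp add: carr sum.cartesian_product case_prod_unfold)
  also have "\<dots> = (\<Sum>x'\<in>carrier V. \<Sum>x\<in>carrier V. \<Sum>a'\<in>carrier M. \<Sum>a\<in>carrier M. ?P x a x' a')"
    by (rule sum.cong[OF refl], rule sum.swap)
  also have "\<dots> = (\<Sum>x\<in>carrier V. \<Sum>x'\<in>carrier V. \<Sum>a'\<in>carrier M. \<Sum>a\<in>carrier M. ?P x a x' a')"
    by (rule sum.swap)
  also have "\<dots> = (\<Sum>x\<in>carrier V. \<Sum>x'\<in>carrier V. \<Sum>a\<in>carrier M. \<Sum>a'\<in>carrier M. ?P x a x' a')"
    by (rule sum.cong[OF refl], rule sum.cong[OF refl], rule sum.swap)
  finally show ?thesis
    unfolding 2 .
qed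

text \<open>Both sides count the triples \<open>(\<psi>, x, x')\<close> such that \<open>\<psi>\<close> vanishes on \<open>x * M\<close> and on \<open>x' * M\<close>.\<close>

lemma sum_card_kernel_bullet_dual_squared:
  assumes \<theta>: "module_rep R M V W \<theta>"
    and fin: "finite (carrier V)" "finite (carrier (dual_module R W))"
  shows "(\<Sum>\<psi>\<in>carrier (dual_module R W). real (card (a_kernel V (dual_module R M) (bullet_dual M V \<theta> \<psi>))) ^ 2) =
    (\<Sum>x\<in>carrier V. \<Sum>x'\<in>carrier V. real (card (functionals_vanishing R W (carrier W)
      (bracket W \<theta> x x' ` (carrier M \<times> carrier M)))))"
proof -
  let ?k = "\<lambda>\<psi> x. \<forall>a\<in>carrier M. \<psi> (\<theta> a x) = \<zero>\<^bsub>R\<^esub>"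
  have "(\<Sum>\<psi>\<in>carrier (dual_module R W). real (card (a_kernel V (dual_module R M) (bullet_dual M V \<theta> \<psi>))) ^ 2)
      = (\<Sum>\<psi>\<in>carrier (dual_module R W). \<Sum>x\<in>carrier V. \<Sum>x'\<in>carrier V. of_bool (?k \<psi> x \<and> ?k \<psi> x'))"
    unfolding a_kernel_bullet_dual card_eq_sum_of_bool[OF fin(1)] power2_eq_square sum_product
      of_bool_conj ..
  also have "\<dots> = (\<Sum>x\<in>carrier V. \<Sum>\<psi>\<in>carrier (dual_module R W). \<Sum>x'\<in>carrier V. of_bool (?k \<psi> x \<and> ?k \<psi> x'))"
    by (rule sum.swap)
  also have "\<dots> = (\<Sum>x\<in>carrier V. \<Sum>x'\<in>carrier V. \<Sum>\<psi>\<in>carrier (dual_module R W). of_bool (?k \<psi> x \<and> ?k \<psi> x'))"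
    by (rule sum.cong[OF refl], rule sum.swap)
  also have "\<dots> = (\<Sum>x\<in>carrier V. \<Sum>x'\<in>carrier V. real (card (functionals_vanishing R W (carrier W)
      (bracket W \<theta> x x' ` (carrier M \<times> carrier M)))))"
    unfolding functionals_vanishing_carrier card_eq_sum_of_bool[OF fin(2)]
    by (intro sum.cong refl arg_cong[where f = of_bool] vanishes_on_bracket_iff[OF \<theta>, symmetric])
  finally show ?thesis .
qed

theorem theorem7p9:
  fixes R :: "('r, 'x) ring_scheme"
    and M :: "('r, 'm, 'y1) module_scheme"
    and V :: "('r, 'v, 'y2) module_scheme"
    and W :: "('r, 'w, 'y3) module_scheme"
    and \<theta> :: "'m \<Rightarrow> 'v \<Rightarrow> 'w"
  assumes "truncated_dvr TYPE('o) R"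
    and "finite (carrier R)"
    and "module_rep R M V W \<theta>"
    and "finite (carrier M)" and "finite (carrier V)" and "finite (carrier W)"
  shows "ask (direct_sum V M) (direct_sum V M) W (alternating_hull M V W \<theta>) =
    real (card (carrier M)) / real (card (carrier V)) *
      ask_pow 2 (dual_module R W) V (dual_module R M) (bullet_dual M V \<theta>)"
proof -
  note \<theta> = assms(3) and fin = assms(2,4-6)
  interpret M: module R M using \<theta> by (simp add: module_rep_def)
  interpret V: module R V using \<theta> by (simp add: module_rep_def)
  have W: "module R W" using \<theta> by (simp add: module_rep_def)
  interpret W: module_over_principal_quasi_frobenius_ring R W
    by (intro module_over_principal_quasi_frobenius_ring.intro W
        truncated_dvr_imp_principal_quasi_frobenius_ring[OF assms(1)])
  let ?D = "functionals_vanishing R W (carrier W)"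
  let ?N = "\<lambda>x x'. bracket W \<theta> x x' ` (carrier M \<times> carrier M)"
  let ?K = "\<lambda>x x'. a_kernel (direct_sum M M) W (bracket W \<theta> x x')"
  have pos: "card (carrier M) > 0" "card (carrier V) > 0" "card (carrier W) > 0"
    using fin M.M.zero_closed V.M.zero_closed W.M.zero_closed by (auto simp: card_gt_0_iff)
  have MM: "module R (direct_sum M M)"
    by (intro direct_sum_is_module M.module_axioms)
  have sub: "Module.submodule (?N x x') R W" and ker: "card (?K x x') * card (?N x x') = card (carrier M) ^ 2"
    if "x \<in> carrier V" "x' \<in> carrier V" for x x'
  proof -
    note hom = bracket_module_hom[OF \<theta> that]
    have carr: "carrier (direct_sum M M) = carrier M \<times> carrier M"
      by (simp add: direct_sum_def)
    show "Module.submodule (?N x x') R W"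
      using W.submodule_image_module_hom[OF MM hom] by (simp add: carr)
    show "card (?K x x') * card (?N x x') = card (carrier M) ^ 2"
      using card_kernel_times_card_image_module_hom[OF MM W hom] fin
      by (simp add: carr card_cartesian_product power2_eq_square)
  qed
  have key: "real (card (?K x x')) * real (card (carrier W)) =
      real (card (carrier M)) ^ 2 * real (card (?D (?N x x')))"
    if x: "x \<in> carrier V" "x' \<in> carrier V" for x x'
  proof -
    \<comment> \<open>Both \<open>|M|\<^sup>2 / |K|\<close> and \<open>|W| / |N\<^sup>\<bottom>|\<close> are the size of \<open>N\<close>.\<close>
    have "card (?K x x') * card (carrier W) = card (?K x x') * (card (?D (?N x x')) * card (?N x x'))"
      using W.card_functionals_vanishing[OF sub[OF x] fin(1,4)] by simp
    also have "\<dots> = (card (?K x x') * card (?N x x')) * card (?D (?N x x'))"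
      by (simp only: mult_ac)
    also have "\<dots> = card (carrier M) ^ 2 * card (?D (?N x x'))"
      by (simp only: ker[OF x])
    finally have "card (?K x x') * card (carrier W) = card (carrier M) ^ 2 * card (?D (?N x x'))" .
    then show ?thesis
      by (metis of_nat_mult of_nat_power)
  qed
  \<comment> \<open>The case \<open>N = 0\<close> gives \<open>|W\<^sup>*| = |W|\<close>, the denominator of the average on the right.\<close>
  have zero_sub: "Module.submodule {\<zero>\<^bsub>W\<^esub>} R W"
    by (rule W.submoduleI) auto
  have "carrier (dual_module R W) = ?D {\<zero>\<^bsub>W\<^esub>}"
    by (auto simp: functionals_vanishing_carrier dual_module_apply_zero[OF W])
  then have dual: "card (carrier (dual_module R W)) = card (carrier W)"
    using W.card_functionals_vanishing[OF zero_sub fin(1,4)] by simp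
  then have fin_dual: "finite (carrier (dual_module R W))"
    using pos(3) card_gt_0_iff by metis
  let ?S = "\<Sum>x\<in>carrier V. \<Sum>x'\<in>carrier V. real (card (?K x x'))"
  let ?T = "\<Sum>x\<in>carrier V. \<Sum>x'\<in>carrier V. real (card (?D (?N x x')))"
  have "?S * real (card (carrier W)) = real (card (carrier M)) ^ 2 * ?T"
    unfolding sum_distrib_left sum_distrib_right by (intro sum.cong refl key)
  then have "?S / (real (card (carrier V)) * real (card (carrier M))) =
      real (card (carrier M)) / real (card (carrier V)) * (1 / real (card (carrier W)) * ?T)"
    using pos by (simp add: field_simps power2_eq_square)
  moreover have "card (carrier (direct_sum V M)) = card (carrier V) * card (carrier M)"
    by (simp add: direct_sum_def card_cartesian_product)
  ultimately show ?thesis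
    unfolding ask_pow_def dual sum_card_kernel_bullet_dual_squared[OF \<theta> fin(3) fin_dual]
      power_one_right sum_card_kernel_alternating_hull[OF \<theta> fin(2,3)]
    by simp
qed

end
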